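(* Let $m$ be a finite measure on $\mathcal{T}$. For all $\alpha\in(0,1]$, the function $$(U,V)\mapsto m(U)^{\alpha}+m(V)^{\alpha}-m(U\bigtriangleup V)^{\alpha},$$ defined for measurable subsets $U,V$ of $\mathcal{T}$, is positive definite.
   Context: $\mathcal{T}$ is a locally compact complete separable metric space, with its Borel $\sigma$-algebra; $U\bigtriangleup V=(U\setminus V)\cup(V\setminus U)$. A symmetric real function $\Phi(U,V)$ is called positive definite if for all $n\ge1$, all $U_1,\dots,U_n$ and all $u_1,\dots,u_n\in\mathbf{R}$, $\sum_{i=1}^n\sum_{j=1}^n\Phi(U_i,U_j)u_iu_j\ge 0$. *)

theory Defs
  imports "HOL-Analysis.Analysis"
begin

(* The points U 1, ..., U n need not be distinct. As in the usual convention for kernels,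
   "positive definite" is a weak inequality (positive semidefinite Gram matrices). *)
definition positive_definite_on :: "'b set \<Rightarrow> ('b \<Rightarrow> 'b \<Rightarrow> real) \<Rightarrow> bool" where
  "positive_definite_on S \<Phi> \<longleftrightarrow>
     (\<forall>U\<in>S. \<forall>V\<in>S. \<Phi> U V = \<Phi> V U) \<and>
     (\<forall>n\<ge>1. \<forall>(U :: nat \<Rightarrow> 'b) (u :: nat \<Rightarrow> real).
        (\<forall>i\<in>{1..n}. U i \<in> S) \<longrightarrow>
        (\<Sum>i=1..n. \<Sum>j=1..n. \<Phi> (U i) (U j) * u i * u j) \<ge> 0)"

end

theory Submission
  imports Defs
begin

text \<open>
  If \<open>E\<close> is positive definite, then so is \<open>E U V - E U p - E p V + E p p\<close> for every point \<open>p\<close>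
  (\<open>positive_definite_on_centered\<close>). With \<open>p = {}\<close> and \<open>E U V = g (m (U \<triangle> V))\<close> this is the
  kernel \<open>g (m (U \<triangle> V)) - g (m U) - g (m V) + g 0\<close>, in which only the sign differs from the
  kernel of the theorem when \<open>g\<close> is a power. It is therefore enough to write the power as a
  combination, with nonpositive coefficients and up to an additive constant, of functions \<open>g\<close>
  for which \<open>g (m (U \<triangle> V))\<close> is positive definite.

  The functions are \<open>g\<^sub>k s = (C - s) ^ k\<close> with \<open>C > 0\<close> at least the total mass. Since
  \<open>m(\<T>) - m(U \<triangle> V) = m(U \<inter> V) + m(U\<^sup>c \<inter> V\<^sup>c)\<close>, the kernel \<open>C - m(U \<triangle> V)\<close> is positive definite.
  Its powers are so as well, because multiplying a positive definite \<open>K\<close> by \<open>m(U \<inter> V)\<close> turns the quadratic form of \<open>K\<close> into the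
  integral over \<open>x\<close> of quadratic forms of \<open>K\<close> with coefficients \<open>u i * indicator (U i) x\<close>
  (\<open>positive_definite_on_mult_measure_Int\<close>).

  After scaling to \<open>C = 1\<close> the power is given by the binomial series
  \<open>s\<^sup>\<alpha> = (1 - (1 - s))\<^sup>\<alpha> = 1 + \<Sum>\<^bsub>k\<ge>1\<^esub> (-1)\<^sup>k (\<alpha> gchoose k) (1 - s)\<^sup>k\<close>. For \<open>0 < \<alpha> \<le> 1\<close> each
  coefficient with \<open>k \<ge> 1\<close> is nonpositive, which is the required sign. The point \<open>s = 0\<close>, where
  the series is on the boundary of its disc of convergence, does occur (already for \<open>U = V\<close>).
  Replacing \<open>1 - s\<close> by \<open>r (1 - s)\<close> with \<open>r < 1\<close> and letting \<open>r\<close> tend to 1 avoids it.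
\<close>

section \<open>Closure properties of positive definite kernels\<close>

lemma positive_definite_onI:
  assumes "\<And>U V. U \<in> S \<Longrightarrow> V \<in> S \<Longrightarrow> \<Phi> U V = \<Phi> V U"
    and "\<And>n (U :: nat \<Rightarrow> 'b) u. (\<And>i. i \<in> {1..n} \<Longrightarrow> U i \<in> S) \<Longrightarrow>
           0 \<le> (\<Sum>i=1..n. \<Sum>j=1..n. \<Phi> (U i) (U j) * u i * u j)"
  shows "positive_definite_on S \<Phi>"
  using assms unfolding positive_definite_on_def by blast

lemma positive_definite_on_sym:
  assumes "positive_definite_on S \<Phi>" "U \<in> S" "V \<in> S"
  shows "\<Phi> U V = \<Phi> V U"
  using assms unfolding positive_definite_on_def by blast

lemma positive_definite_on_nonneg:
  assumes "positive_definite_on S \<Phi>" "\<And>i. i \<in> {1..n::nat} \<Longrightarrow> U i \<in> S"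
  shows "0 \<le> (\<Sum>i=1..n. \<Sum>j=1..n. \<Phi> (U i) (U j) * u i * u j)"
  using assms unfolding positive_definite_on_def by (cases "n = 0") auto

lemma positive_definite_on_cong:
  assumes "positive_definite_on S \<Phi>"
    and eq: "\<And>U V. U \<in> S \<Longrightarrow> V \<in> S \<Longrightarrow> \<Psi> U V = \<Phi> U V"
  shows "positive_definite_on S \<Psi>"
proof (rule positive_definite_onI)
  show "\<Psi> U V = \<Psi> V U" if "U \<in> S" "V \<in> S" for U V
    using positive_definite_on_sym[OF assms(1) that] eq that by simp
next
  fix n :: nat and U u assume U: "\<And>i. i \<in> {1..n} \<Longrightarrow> U i \<in> S"
  have "(\<Sum>i=1..n. \<Sum>j=1..n. \<Psi> (U i) (U j) * u i * u j)
      = (\<Sum>i=1..n. \<Sum>j=1..n. \<Phi> (U i) (U j) * u i * u j)"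
    using U eq by (intro sum.cong refl) auto
  then show "0 \<le> (\<Sum>i=1..n. \<Sum>j=1..n. \<Psi> (U i) (U j) * u i * u j)"
    using positive_definite_on_nonneg[OF assms(1) U] by simp
qed

lemma positive_definite_on_const:
  assumes "0 \<le> c"
  shows "positive_definite_on S (\<lambda>U V. c)"
proof (rule positive_definite_onI)
  fix n :: nat and u :: "nat \<Rightarrow> real"
  have "(\<Sum>i=1..n. \<Sum>j=1..n. c * u i * u j) = c * (\<Sum>i=1..n. u i)\<^sup>2"
    unfolding power2_eq_square sum_product by (simp add: sum_distrib_left mult.assoc)
  then show "0 \<le> (\<Sum>i=1..n. \<Sum>j=1..n. c * u i * u j)"
    using assms by simp
qed simp

lemma positive_definite_on_cmult:
  assumes "positive_definite_on S \<Phi>" "0 \<le> c"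
  shows "positive_definite_on S (\<lambda>U V. c * \<Phi> U V)"
proof (rule positive_definite_onI)
  show "c * \<Phi> U V = c * \<Phi> V U" if "U \<in> S" "V \<in> S" for U V
    using positive_definite_on_sym[OF assms(1) that] by simp
next
  fix n :: nat and U u assume U: "\<And>i. i \<in> {1..n} \<Longrightarrow> U i \<in> S"
  have "(\<Sum>i=1..n. \<Sum>j=1..n. c * \<Phi> (U i) (U j) * u i * u j)
      = c * (\<Sum>i=1..n. \<Sum>j=1..n. \<Phi> (U i) (U j) * u i * u j)"
    by (simp add: sum_distrib_left mult.assoc)
  then show "0 \<le> (\<Sum>i=1..n. \<Sum>j=1..n. c * \<Phi> (U i) (U j) * u i * u j)"
    using positive_definite_on_nonneg[OF assms(1) U] assms(2) by simp
qed

lemma positive_definite_on_add: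
  assumes "positive_definite_on S \<Phi>" "positive_definite_on S \<Psi>"
  shows "positive_definite_on S (\<lambda>U V. \<Phi> U V + \<Psi> U V)"
proof (rule positive_definite_onI)
  show "\<Phi> U V + \<Psi> U V = \<Phi> V U + \<Psi> V U" if "U \<in> S" "V \<in> S" for U V
    using assms[THEN positive_definite_on_sym, OF that] by simp
next
  fix n :: nat and U u assume U: "\<And>i. i \<in> {1..n} \<Longrightarrow> U i \<in> S"
  show "0 \<le> (\<Sum>i=1..n. \<Sum>j=1..n. (\<Phi> (U i) (U j) + \<Psi> (U i) (U j)) * u i * u j)"
    using positive_definite_on_nonneg[OF assms(1) U] positive_definite_on_nonneg[OF assms(2) U]
    by (simp add: distrib_right sum.distrib)
qed

lemma positive_definite_on_sum:
  assumes "\<And>k. k \<in> I \<Longrightarrow> positive_definite_on S (\<Phi> k)"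
  shows "positive_definite_on S (\<lambda>U V. \<Sum>k\<in>I. \<Phi> k U V)"
  using assms
proof (induction I rule: infinite_finite_induct)
  case (insert k I)
  then show ?case by (simp add: positive_definite_on_add)
qed (simp_all add: positive_definite_on_const)

lemma positive_definite_on_tendsto:
  assumes pd: "eventually (\<lambda>x. positive_definite_on S (\<Phi> x)) F" and "F \<noteq> bot"
    and lim: "\<And>U V. U \<in> S \<Longrightarrow> V \<in> S \<Longrightarrow> ((\<lambda>x. \<Phi> x U V) \<longlongrightarrow> \<Psi> U V) F"
  shows "positive_definite_on S \<Psi>"
proof (rule positive_definite_onI)
  fix U V assume UV: "U \<in> S" "V \<in> S"
  have "eventually (\<lambda>x. \<Phi> x V U = \<Phi> x U V) F"
    using pd by eventually_elim (use UV in \<open>auto intro: positive_definite_on_sym\<close>)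
  with lim[OF UV(2,1)] have "((\<lambda>x. \<Phi> x U V) \<longlongrightarrow> \<Psi> V U) F"
    by (rule Lim_transform_eventually)
  with lim[OF UV] show "\<Psi> U V = \<Psi> V U"
    using \<open>F \<noteq> bot\<close> tendsto_unique by blast
next
  fix n :: nat and U u assume U: "\<And>i. i \<in> {1..n} \<Longrightarrow> U i \<in> S"
  have "((\<lambda>x. \<Sum>i=1..n. \<Sum>j=1..n. \<Phi> x (U i) (U j) * u i * u j)
          \<longlongrightarrow> (\<Sum>i=1..n. \<Sum>j=1..n. \<Psi> (U i) (U j) * u i * u j)) F"
    by (intro tendsto_intros lim U)
  moreover have "eventually (\<lambda>x. 0 \<le> (\<Sum>i=1..n. \<Sum>j=1..n. \<Phi> x (U i) (U j) * u i * u j)) F"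
    using pd by eventually_elim (rule positive_definite_on_nonneg[OF _ U])
  ultimately show "0 \<le> (\<Sum>i=1..n. \<Sum>j=1..n. \<Psi> (U i) (U j) * u i * u j)"
    using \<open>F \<noteq> bot\<close> by (rule tendsto_lowerbound)
qed

lemma positive_definite_on_sums:
  assumes "\<And>k. positive_definite_on S (\<Phi> k)"
    and "\<And>U V. U \<in> S \<Longrightarrow> V \<in> S \<Longrightarrow> (\<lambda>k. \<Phi> k U V) sums \<Psi> U V"
  shows "positive_definite_on S \<Psi>"
proof (rule positive_definite_on_tendsto[where F = sequentially])
  show "eventually (\<lambda>n. positive_definite_on S (\<lambda>U V. \<Sum>k<n. \<Phi> k U V)) sequentially"
    by (intro always_eventually allI positive_definite_on_sum assms)
  show "(\<lambda>n. \<Sum>k<n. \<Phi> k U V) \<longlonglongrightarrow> \<Psi> U V" if "U \<in> S" "V \<in> S" for U V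
    using assms(2)[OF that] by (simp add: sums_def)
qed simp

text \<open>
  In a Hilbert space picture, with \<open>\<Phi> U V\<close> the inner product of vectors \<open>e U\<close> and \<open>e V\<close>, the new
  kernel is the inner product of \<open>e U - e p\<close> and \<open>e V - e p\<close>. On quadratic forms this amounts to
  adding the point \<open>p\<close> with the weight that makes the total weight zero.
\<close>

lemma positive_definite_on_centered:
  assumes pd: "positive_definite_on S \<Phi>" and p: "p \<in> S"
  shows "positive_definite_on S (\<lambda>U V. \<Phi> U V - \<Phi> U p - \<Phi> p V + \<Phi> p p)"
proof (rule positive_definite_onI)
  show "\<Phi> U V - \<Phi> U p - \<Phi> p V + \<Phi> p p = \<Phi> V U - \<Phi> V p - \<Phi> p U + \<Phi> p p"
    if "U \<in> S" "V \<in> S" for U V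
    using positive_definite_on_sym[OF pd] that p by simp
next
  fix n :: nat and U and u :: "nat \<Rightarrow> real" assume U: "\<And>i. i \<in> {1..n} \<Longrightarrow> U i \<in> S"
  define s where "s = (\<Sum>i=1..n. u i)"
  define U' where "U' = U(Suc n := p)"
  define u' where "u' = u(Suc n := - s)"
  have old: "U' i = U i" "u' i = u i" if "i \<in> {1..n}" for i
    using that by (auto simp: U'_def u'_def)
  have new: "U' (Suc n) = p" "u' (Suc n) = - s"
    by (simp_all add: U'_def u'_def)
  have "0 \<le> (\<Sum>i=1..Suc n. \<Sum>j=1..Suc n. \<Phi> (U' i) (U' j) * u' i * u' j)"
    by (rule positive_definite_on_nonneg[OF pd]) (use U p in \<open>auto simp: U'_def\<close>)
  also have "\<dots> = (\<Sum>i=1..n. \<Sum>j=1..n. \<Phi> (U' i) (U' j) * u' i * u' j)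
      + (\<Sum>i=1..n. \<Phi> (U' i) p * u' i * - s)
      + (\<Sum>j=1..n. \<Phi> p (U' j) * - s * u' j) + \<Phi> p p * s * s"
    by (simp add: new algebra_simps sum_subtractf sum_negf)
  also have "\<dots> = (\<Sum>i=1..n. \<Sum>j=1..n. \<Phi> (U i) (U j) * u i * u j)
      + (\<Sum>i=1..n. \<Phi> (U i) p * u i * - s)
      + (\<Sum>j=1..n. \<Phi> p (U j) * - s * u j) + \<Phi> p p * s * s"
    by (intro arg_cong2[where f = "(+)"] sum.cong refl) (simp_all only: old)
  also have "\<dots> = (\<Sum>i=1..n. \<Sum>j=1..n.
      (\<Phi> (U i) (U j) - \<Phi> (U i) p - \<Phi> p (U j) + \<Phi> p p) * u i * u j)"
  proof -
    have "(\<Sum>i=1..n. \<Phi> (U i) p * u i * - s) = - (\<Sum>i=1..n. \<Sum>j=1..n. \<Phi> (U i) p * u i * u j)"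
      by (simp add: s_def sum_distrib_left sum_negf)
    moreover have "(\<Sum>j=1..n. \<Phi> p (U j) * - s * u j)
        = - (\<Sum>i=1..n. \<Sum>j=1..n. \<Phi> p (U j) * u i * u j)"
      by (subst sum.swap) (simp add: s_def sum_distrib_left sum_distrib_right sum_negf)
    moreover have "\<Phi> p p * s * s = (\<Sum>i=1..n. \<Sum>j=1..n. \<Phi> p p * u i * u j)"
      unfolding s_def mult.assoc sum_product by (simp add: sum_distrib_left)
    ultimately show ?thesis
      by (simp add: algebra_simps sum.distrib sum_subtractf)
  qed
  finally show "0 \<le> (\<Sum>i=1..n. \<Sum>j=1..n.
      (\<Phi> (U i) (U j) - \<Phi> (U i) p - \<Phi> p (U j) + \<Phi> p p) * u i * u j)" .
qed

section \<open>Kernels built from the measure of an intersection\<close>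

text \<open>
  Writing \<open>measure M (A \<inter> B)\<close> as the integral of \<open>1\<^sub>A 1\<^sub>B\<close> absorbs the indicators into the
  coefficients: at each point \<open>x\<close> the integrand is the quadratic form of \<open>\<Phi>\<close> with coefficients
  \<open>u i * indicator (F (U i)) x\<close>. The map \<open>F\<close> allows complements as well as the sets themselves.
\<close>

lemma (in finite_measure) positive_definite_on_mult_measure_Int:
  assumes pd: "positive_definite_on S \<Phi>" and F: "\<And>U. U \<in> S \<Longrightarrow> F U \<in> sets M"
  shows "positive_definite_on S (\<lambda>U V. \<Phi> U V * measure M (F U \<inter> F V))"
proof (rule positive_definite_onI)
  show "\<Phi> U V * measure M (F U \<inter> F V) = \<Phi> V U * measure M (F V \<inter> F U)"
    if "U \<in> S" "V \<in> S" for U V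
    using positive_definite_on_sym[OF pd that] by (simp add: Int_commute)
next
  fix n :: nat and U and u :: "nat \<Rightarrow> real" assume U: "\<And>i. i \<in> {1..n} \<Longrightarrow> U i \<in> S"
  define g where "g i j x = \<Phi> (U i) (U j) * u i * u j * indicator (F (U i) \<inter> F (U j)) x" for i j x
  have FU: "F (U i) \<inter> F (U j) \<in> sets M" if "i \<in> {1..n}" "j \<in> {1..n}" for i j
    using that U F by blast
  have integrable_g: "integrable M (g i j)"
    and integral_g: "integral\<^sup>L M (g i j) = \<Phi> (U i) (U j) * measure M (F (U i) \<inter> F (U j)) * u i * u j"
    if "i \<in> {1..n}" "j \<in> {1..n}" for i j
  proof -
    have *: "has_bochner_integral M (indicator (F (U i) \<inter> F (U j)))
        (measure M (F (U i) \<inter> F (U j)))"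
      using FU[OF that] by (intro has_bochner_integral_real_indicator) (simp_all add: emeasure_eq_measure)
    have "has_bochner_integral M (g i j)
        (\<Phi> (U i) (U j) * u i * u j * measure M (F (U i) \<inter> F (U j)))"
      unfolding g_def by (intro has_bochner_integral_mult_right *)
    then show "integrable M (g i j)"
      "integral\<^sup>L M (g i j) = \<Phi> (U i) (U j) * measure M (F (U i) \<inter> F (U j)) * u i * u j"
      by (auto simp: has_bochner_integral_iff)
  qed
  have "(\<Sum>i=1..n. \<Sum>j=1..n. \<Phi> (U i) (U j) * measure M (F (U i) \<inter> F (U j)) * u i * u j)
      = (\<Sum>i=1..n. \<Sum>j=1..n. integral\<^sup>L M (g i j))"
    by (intro sum.cong refl) (simp only: integral_g)
  also have "\<dots> = (\<Sum>i=1..n. \<integral>x. (\<Sum>j=1..n. g i j x) \<partial>M)"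
    by (intro sum.cong refl Bochner_Integration.integral_sum[symmetric] integrable_g)
  also have "\<dots> = (\<integral>x. (\<Sum>i=1..n. \<Sum>j=1..n. g i j x) \<partial>M)"
    by (intro Bochner_Integration.integral_sum[symmetric] Bochner_Integration.integrable_sum
        integrable_g)
  also have "\<dots> \<ge> 0"
  proof (rule Bochner_Integration.integral_nonneg)
    fix x
    have "(\<Sum>i=1..n. \<Sum>j=1..n. g i j x) = (\<Sum>i=1..n. \<Sum>j=1..n. \<Phi> (U i) (U j)
        * (u i * indicator (F (U i)) x) * (u j * indicator (F (U j)) x))"
      by (simp add: g_def indicator_inter_arith ac_simps)
    then show "0 \<le> (\<Sum>i=1..n. \<Sum>j=1..n. g i j x)"
      using positive_definite_on_nonneg[OF pd U] by simp
  qed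
  finally show "0 \<le> (\<Sum>i=1..n. \<Sum>j=1..n.
      \<Phi> (U i) (U j) * measure M (F (U i) \<inter> F (U j)) * u i * u j)" .
qed

lemma (in finite_measure) measure_sym_diff_complement:
  assumes "U \<in> sets M" "V \<in> sets M"
  shows "measure M (space M) - measure M (sym_diff U V)
    = measure M (U \<inter> V) + measure M ((space M - U) \<inter> (space M - V))"
proof -
  have "measure M (space M) - measure M (sym_diff U V) = measure M (space M - sym_diff U V)"
    using assms by (simp add: finite_measure_compl)
  also have "space M - sym_diff U V = (U \<inter> V) \<union> ((space M - U) \<inter> (space M - V))"
    using assms[THEN sets.sets_into_space] by blast
  also have "measure M \<dots> = measure M (U \<inter> V) + measure M ((space M - U) \<inter> (space M - V))"
    using assms by (intro finite_measure_Union) auto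
  finally show ?thesis .
qed

lemma (in finite_measure) positive_definite_on_power_measure_sym_diff:
  assumes C: "measure M (space M) \<le> C"
  shows "positive_definite_on (sets M) (\<lambda>U V. (C - measure M (sym_diff U V)) ^ k)"
proof (induction k)
  case 0
  then show ?case by (simp add: positive_definite_on_const)
next
  case (Suc k)
  define E where "E U V = (C - measure M (sym_diff U V)) ^ k" for U V
  have E: "positive_definite_on (sets M) E"
    using Suc by (simp add: E_def[abs_def])
  have "positive_definite_on (sets M) (\<lambda>U V. (C - measure M (space M)) * E U V
      + E U V * measure M (U \<inter> V) + E U V * measure M ((space M - U) \<inter> (space M - V)))"
    using C by (intro positive_definite_on_add positive_definite_on_cmult
        positive_definite_on_mult_measure_Int E) auto
  then show ?case
  proof (rule positive_definite_on_cong)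
    fix U V assume UV: "U \<in> sets M" "V \<in> sets M"
    have "C - measure M (sym_diff U V) = (C - measure M (space M)) + measure M (U \<inter> V)
        + measure M ((space M - U) \<inter> (space M - V))"
      using measure_sym_diff_complement[OF UV] by simp
    then have "(C - measure M (sym_diff U V)) ^ Suc k = ((C - measure M (space M))
        + measure M (U \<inter> V) + measure M ((space M - U) \<inter> (space M - V))) * E U V"
      by (simp only: power_Suc E_def)
    then show "(C - measure M (sym_diff U V)) ^ Suc k = (C - measure M (space M)) * E U V
      + E U V * measure M (U \<inter> V) + E U V * measure M ((space M - U) \<inter> (space M - V))"
      by (simp add: algebra_simps)
  qed
qed

section \<open>The binomial series\<close>

text \<open>
  The recursion \<open>\<alpha> gchoose (k + 1) = (\<alpha> gchoose k) * (\<alpha> - k) / (k + 1)\<close> changes the sign at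
  every \<open>k \<ge> 1\<close>, because there \<open>\<alpha> \<le> 1 \<le> k\<close>.
\<close>

lemma alternating_gbinomial_nonpos:
  fixes \<alpha> :: real
  assumes "0 \<le> \<alpha>" "\<alpha> \<le> 1"
  shows "(-1) ^ Suc k * (\<alpha> gchoose Suc k) \<le> 0"
proof (induction k)
  case 0
  then show ?case using assms by simp
next
  case (Suc k)
  have rec: "\<alpha> gchoose Suc (Suc k) = (\<alpha> gchoose Suc k) * (\<alpha> - real (Suc k)) / real (Suc (Suc k))"
    using gbinomial_absorption[of "Suc k" \<alpha>] gbinomial_absorb_comp[of \<alpha> "Suc k"]
    by (simp add: field_simps)
  have "(-1) ^ Suc (Suc k) * (\<alpha> gchoose Suc (Suc k))
      = ((-1) ^ Suc k * (\<alpha> gchoose Suc k)) * ((real (Suc k) - \<alpha>) / real (Suc (Suc k)))"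
    by (simp add: rec field_simps)
  also have "\<dots> \<le> 0"
    using assms by (intro mult_nonpos_nonneg Suc.IH divide_nonneg_nonneg) auto
  finally show ?case .
qed

text \<open>
  In this regularised kernel \<open>r < 1\<close> keeps the binomial series inside its disc of convergence.
  The term \<open>(1 - r) powr \<alpha>\<close>, the value of the regularised power at mass zero, makes
  each term of the series a centred kernel; it vanishes in the limit \<open>r \<rightarrow> 1\<close>.
\<close>

lemma (in finite_measure) positive_definite_on_regularised_powr:
  assumes \<alpha>: "0 \<le> \<alpha>" "\<alpha> \<le> 1" and r: "0 < r" "r < 1"
    and C: "measure M (space M) \<le> C" "0 < C"
  defines "f \<equiv> (\<lambda>A. (1 - r * (1 - measure M A / C)) powr \<alpha>)"
  shows "positive_definite_on (sets M) (\<lambda>U V. f U + f V - f (sym_diff U V) - (1 - r) powr \<alpha>)"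
proof -
  define b where "b k = (-1) ^ k * (\<alpha> gchoose k) * r ^ k" for k
  define e where "e k A = (1 - measure M A / C) ^ k" for k A
  have f: "(\<lambda>k. b k * e k A) sums f A" for A
  proof -
    have "measure M A \<le> C"
      using bounded_measure[of A] C by simp
    then have "0 \<le> 1 - measure M A / C" "1 - measure M A / C \<le> 1"
      using C by auto
    then have "0 \<le> r * (1 - measure M A / C)" "r * (1 - measure M A / C) < 1"
      using r mult_left_le[of "1 - measure M A / C" r] by (simp, linarith)
    then have "\<bar>- (r * (1 - measure M A / C))\<bar> < 1"
      by simp
    from gen_binomial_real[OF this, of \<alpha>] show ?thesis
      by (simp add: f_def b_def e_def power_minus[of "r * _"] power_mult_distrib ac_simps)
  qed
  have f0: "f {} = (1 - r) powr \<alpha>"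
    by (simp add: f_def)
  show ?thesis
  proof (rule positive_definite_on_sums)
    fix k
    have "positive_definite_on (sets M) (\<lambda>U V. (C - measure M (sym_diff U V)) ^ k)"
      by (rule positive_definite_on_power_measure_sym_diff[OF C(1)])
    then have "positive_definite_on (sets M)
        (\<lambda>U V. (1 / C) ^ k * (C - measure M (sym_diff U V)) ^ k)"
      using C by (intro positive_definite_on_cmult) auto
    then have "positive_definite_on (sets M) (\<lambda>U V. e k (sym_diff U V))"
      using C by (rule_tac positive_definite_on_cong)
        (auto simp: e_def power_mult_distrib[symmetric] field_simps)
    from positive_definite_on_centered[OF this, of "{}"]
    have centered: "positive_definite_on (sets M)
        (\<lambda>U V. e k (sym_diff U V) - e k U - e k V + e k {})"
      by simp
    show "positive_definite_on (sets M)
        (\<lambda>U V. - b k * (e k (sym_diff U V) - e k U - e k V + e k {}))"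
    proof (cases k)
      case 0
      \<comment> \<open>The coefficient has the wrong sign, but the centred constant kernel is zero.\<close>
      then show ?thesis by (simp add: e_def positive_definite_on_const)
    next
      case (Suc l)
      then have "b k \<le> 0"
        using mult_nonpos_nonneg[OF alternating_gbinomial_nonpos[OF \<alpha>, of l], of "r ^ k"] r
        by (simp add: b_def)
      then show ?thesis
        by (intro positive_definite_on_cmult centered) simp
    qed
  next
    fix U V
    have "(\<lambda>k. b k * e k U + b k * e k V - b k * e k (sym_diff U V) - b k * e k {}) sums
        (f U + f V - f (sym_diff U V) - f {})"
      by (intro sums_add sums_diff f)
    then show "(\<lambda>k. - b k * (e k (sym_diff U V) - e k U - e k V + e k {})) sums
        (f U + f V - f (sym_diff U V) - (1 - r) powr \<alpha>)"
      by (simp add: f0 algebra_simps)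
  qed
qed

section \<open>Powers of the measure of a symmetric difference\<close>

theorem (in finite_measure) positive_definite_on_measure_powr:
  assumes \<alpha>: "0 < \<alpha>" "\<alpha> \<le> 1"
  shows "positive_definite_on (sets M)
    (\<lambda>U V. measure M U powr \<alpha> + measure M V powr \<alpha> - measure M (sym_diff U V) powr \<alpha>)"
proof -
  \<comment> \<open>One more than the total mass, so that division by \<open>C\<close> also makes sense for the zero measure.\<close>
  define C where "C = measure M (space M) + 1"
  have C: "measure M (space M) \<le> C" "0 < C"
    by (auto simp: C_def add_nonneg_pos)
  define f where "f r A = (1 - r * (1 - measure M A / C)) powr \<alpha>" for r A
  have lim: "((\<lambda>r. (1 - r * c) powr \<alpha>) \<longlongrightarrow> (1 - c) powr \<alpha>) (at_left 1)" if "c \<le> 1" for c :: real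
  proof (rule tendsto_powr')
    show "((\<lambda>r. 1 - r * c) \<longlongrightarrow> 1 - c) (at_left 1)"
      by (rule tendsto_eq_intros refl | simp)+
    \<comment> \<open>For \<open>c = 1\<close> the limit is zero, and the continuity of \<open>powr\<close> there is taken from the right.\<close>
    have "eventually (\<lambda>r. r \<in> {0<..<1}) (at_left (1::real))"
      by (rule eventually_at_left_real) simp
    then have "eventually (\<lambda>r. 0 \<le> 1 - r * c) (at_left 1)"
    proof eventually_elim
      case (elim r)
      then show ?case using that mult_left_mono[of c 1 r] by (auto intro: order_trans[of _ r])
    qed
    then show "1 - c \<noteq> 0 \<or> 0 < \<alpha> \<and> eventually (\<lambda>r. 0 \<le> 1 - r * c) (at_left 1)"
      using \<alpha> by simp
  qed simp
  have lim_f: "((\<lambda>r. f r A) \<longlongrightarrow> (measure M A / C) powr \<alpha>) (at_left 1)" for A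
    using lim[of "1 - measure M A / C"] C by (simp add: f_def)
  have lim_0: "((\<lambda>r. (1 - r) powr \<alpha>) \<longlongrightarrow> 0) (at_left 1)"
    using lim[of 1] by simp
  have "positive_definite_on (sets M) (\<lambda>U V. (measure M U / C) powr \<alpha>
      + (measure M V / C) powr \<alpha> - (measure M (sym_diff U V) / C) powr \<alpha> - 0)"
  proof (rule positive_definite_on_tendsto)
    have "eventually (\<lambda>r. r \<in> {0<..<1}) (at_left (1::real))"
      by (rule eventually_at_left_real) simp
    then show "eventually (\<lambda>r. positive_definite_on (sets M)
        (\<lambda>U V. f r U + f r V - f r (sym_diff U V) - (1 - r) powr \<alpha>)) (at_left 1)"
    proof eventually_elim
      case (elim r)
      then show ?case
        using positive_definite_on_regularised_powr[of \<alpha> r C] \<alpha> C by (simp add: f_def)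
    qed
  qed (simp, rule tendsto_diff[OF tendsto_diff[OF tendsto_add[OF lim_f lim_f] lim_f] lim_0])
  then have "positive_definite_on (sets M) (\<lambda>U V. C powr \<alpha> * ((measure M U / C) powr \<alpha>
      + (measure M V / C) powr \<alpha> - (measure M (sym_diff U V) / C) powr \<alpha> - 0))"
    by (rule positive_definite_on_cmult) simp
  then show ?thesis
    by (rule positive_definite_on_cong) (use C in \<open>simp add: powr_divide field_simps\<close>)
qed

theorem lemma2p9:
  fixes m :: "'a::polish_space measure" and \<alpha> :: real
  assumes "locally_compact_space (euclidean :: 'a topology)"
    and "finite_measure m"
    and "sets m = sets borel"
    and "\<alpha> \<in> {0<..1}"
  shows "positive_definite_on (sets borel)
    (\<lambda>U V. measure m U powr \<alpha> + measure m V powr \<alpha> - measure m (sym_diff U V) powr \<alpha>)"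
  using finite_measure.positive_definite_on_measure_powr[OF assms(2), of \<alpha>] assms(3,4)
  by simp

end
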